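(* Let $p>3$ be a prime. Then $$\sum_{k=0}^{\frac{p-1}{2}} (6k+1) \left(\frac{(\frac12)_k}{k!}\right)^3 4^{-k}\equiv (-1)^{\frac{p-1}{2}}p \pmod{p^4}.$$
   Context: For $a\in\mathbb{C}$ and $k\in\mathbb{N}$, $(a)_k=a(a+1)\cdots(a+k-1)$ denotes the rising factorial, with $(a)_0=1$. A congruence $A\equiv B \pmod{p^m}$ between rational numbers means that $A-B\in p^m\mathbb{Z}_{(p)}$. *)

theory Defs
  imports Complex_Main "HOL-Computational_Algebra.Primes"
begin

text \<open>The localisation of the integers at the prime ideal \<open>(p)\<close>, as a subring of the rationals.
  The condition on \<open>b\<close> entails \<open>b \<noteq> 0\<close>, since every integer divides \<open>0\<close>.\<close>

definition Z_loc :: "nat \<Rightarrow> rat set" where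
  "Z_loc p = {of_int a / of_int b | a b :: int. \<not> int p dvd b}"

definition rat_cong :: "rat \<Rightarrow> rat \<Rightarrow> nat \<Rightarrow> nat \<Rightarrow> bool" where
  "rat_cong A B p m \<longleftrightarrow> A - B \<in> (\<lambda>x. of_nat p ^ m * x) ` Z_loc p"

end

theory Submission
  imports Defs "HOL-Computational_Algebra.Polynomial"
begin

text \<open>
  The sum belongs to a family with three parameters, the strange series
  \<open>\<Sum> (3k + e) (e)\<^sub>k (-n)\<^sub>k (2c)\<^sub>k (1-2c)\<^sub>k / (k! (1+e+2n)\<^sub>k (e/2-c+1)\<^sub>k (e/2+c+1/2)\<^sub>k 4\<^sup>k)\<close>
  of Gessel and Stanton. With \<open>c = 1/4 + \<beta>\<close> it depends on \<open>c\<close> only through \<open>y = 4\<beta>\<^sup>2\<close>. Half the sum in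
  question is the truncation at \<open>m = (p-1)/2\<close> for \<open>e = 1/2\<close>, \<open>n = -1/2\<close>, \<open>y = 0\<close>.

  Move \<open>e\<close> to \<open>1/2 - p/2 = -m\<close>, \<open>n\<close> by multiples of \<open>p/2\<close>, and \<open>y\<close> to \<open>p\<^sup>2/4\<close>. Each term is a rational
  function with \<open>p\<close>-integral coefficients and unit denominators, so the alternating sum over the eight
  corners is divisible by \<open>p \<cdot> p \<cdot> p\<^sup>2\<close>. At the other corners the sum is known exactly: it vanishes for
  \<open>e = -m\<close>; it is \<open>(1/2)\<^sub>p / \<Prod>\<^sub>j ((2j)\<^sup>2 - y)\<close> for \<open>e = 1/2\<close>, \<open>n = m\<close>, whose values at \<open>y = 0\<close> and
  \<open>y = p\<^sup>2/4\<close> agree modulo \<open>p\<^sup>4\<close> because \<open>p\<close> divides \<open>\<Sum>\<^sub>j 1/j\<^sup>2\<close> over \<open>1 \<le> j \<le> m\<close>; and it is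
  \<open>(-1)\<^sup>m p/2\<close> for \<open>e = 1/2\<close>, \<open>n = -1/2\<close>, \<open>y = p\<^sup>2/4\<close>.

  All three evaluations come from the product formula for natural \<open>n\<close>, which is proved by
  Wilf-Zeilberger telescoping in \<open>n\<close>: a terminating sum is a rational function of each parameter, so
  the formula extends from generic \<open>e\<close> to \<open>e = -m\<close> and, for \<open>y = (m + 1/2)\<^sup>2\<close>, from
  natural \<open>n\<close> to \<open>n = -1/2\<close>.
\<close>

section \<open>Rational functions\<close>

locale function_subring =
  fixes A :: "('c \<Rightarrow> 'a::comm_ring_1) set"
  assumes one: "(\<lambda>_. 1) \<in> A"
    and diff: "f \<in> A \<Longrightarrow> g \<in> A \<Longrightarrow> (\<lambda>x. f x - g x) \<in> A"
    and mult: "f \<in> A \<Longrightarrow> g \<in> A \<Longrightarrow> (\<lambda>x. f x * g x) \<in> A"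
begin

lemma zero: "(\<lambda>_. 0) \<in> A"
  using diff[OF one one] by simp

lemma add: "f \<in> A \<Longrightarrow> g \<in> A \<Longrightarrow> (\<lambda>x. f x + g x) \<in> A"
  using diff[of f "\<lambda>x. 0 - g x"] diff[OF zero, of g] by simp

lemma of_nat: "(\<lambda>_. of_nat n) \<in> A"
  by (induction n) (simp_all add: zero one add)

lemma numeral: "(\<lambda>_. numeral n) \<in> A"
  using of_nat[of "numeral n"] by simp

lemma power: "f \<in> A \<Longrightarrow> (\<lambda>x. f x ^ n) \<in> A"
  by (induction n) (simp_all add: one mult)

lemma sum: "(\<And>i. i \<in> I \<Longrightarrow> f i \<in> A) \<Longrightarrow> (\<lambda>x. \<Sum>i\<in>I. f i x) \<in> A"
  by (induction I rule: infinite_finite_induct) (simp_all add: zero add)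

lemma prod: "(\<And>i. i \<in> I \<Longrightarrow> f i \<in> A) \<Longrightarrow> (\<lambda>x. \<Prod>i\<in>I. f i x) \<in> A"
  by (induction I rule: infinite_finite_induct) (simp_all add: one mult)

lemma pochhammer: "f \<in> A \<Longrightarrow> (\<lambda>x. pochhammer (f x) n) \<in> A"
  unfolding pochhammer_prod by (intro prod add of_nat)

lemmas closed = one zero add diff mult of_nat numeral power sum prod pochhammer

end

text \<open>At the roots of the denominator nothing is required, so junk values at poles are harmless.\<close>

definition rational_at :: "'a::field_char_0 \<Rightarrow> ('a \<Rightarrow> 'a) set" where
  "rational_at a =
     {f. \<exists>P Q. poly Q a \<noteq> 0 \<and> (\<forall>x. poly Q x \<noteq> 0 \<longrightarrow> f x = poly P x / poly Q x)}"

lemma rational_atI: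
  assumes "poly Q a \<noteq> 0" and "\<And>x. poly Q x \<noteq> 0 \<Longrightarrow> f x = poly P x / poly Q x"
  shows "f \<in> rational_at a"
  using assms unfolding rational_at_def by blast

lemma rational_atE:
  assumes "f \<in> rational_at a"
  obtains P Q where "poly Q a \<noteq> 0" and "\<And>x. poly Q x \<noteq> 0 \<Longrightarrow> f x = poly P x / poly Q x"
  using assms unfolding rational_at_def by blast

lemma const_rational_at: "(\<lambda>_. c) \<in> rational_at a"
  by (rule rational_atI[of 1 _ _ "[:c:]"]) simp_all

lemma ident_rational_at: "(\<lambda>x. x) \<in> rational_at a"
  by (rule rational_atI[of 1 _ _ "[:0, 1:]"]) simp_all

lemma inverse_rational_at:
  assumes "f \<in> rational_at a" and "f a \<noteq> 0"
  shows "(\<lambda>x. 1 / f x) \<in> rational_at a"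
proof -
  obtain P Q where Q: "poly Q a \<noteq> 0" and f: "\<And>x. poly Q x \<noteq> 0 \<Longrightarrow> f x = poly P x / poly Q x"
    using assms(1) by (rule rational_atE) blast
  show ?thesis
    by (rule rational_atI[of "P * Q" _ _ "Q * Q"]) (use Q f assms(2) in auto)
qed

interpretation rational_at: function_subring "rational_at a"
proof
  show "(\<lambda>_. 1) \<in> rational_at a"
    by (rule const_rational_at)
next
  fix f g assume "f \<in> rational_at a" and "g \<in> rational_at a"
  then obtain P Q R S where nz: "poly Q a \<noteq> 0" "poly S a \<noteq> 0"
    and f: "\<And>x. poly Q x \<noteq> 0 \<Longrightarrow> f x = poly P x / poly Q x"
    and g: "\<And>x. poly S x \<noteq> 0 \<Longrightarrow> g x = poly R x / poly S x"
    by (elim rational_atE) blast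
  show "(\<lambda>x. f x - g x) \<in> rational_at a"
    by (rule rational_atI[of "Q * S" _ _ "P * S - R * Q"]) (use nz in \<open>auto simp: f g diff_frac_eq\<close>)
  show "(\<lambda>x. f x * g x) \<in> rational_at a"
    by (rule rational_atI[of "Q * S" _ _ "P * R"]) (use nz in \<open>auto simp: f g\<close>)
qed

lemma rational_at_eqI:
  assumes "f \<in> rational_at a" and "g \<in> rational_at a" and inf: "infinite {x. f x = g x}"
  shows "f a = g a"
proof -
  obtain P Q R S where nz: "poly Q a \<noteq> 0" "poly S a \<noteq> 0"
    and f: "\<And>x. poly Q x \<noteq> 0 \<Longrightarrow> f x = poly P x / poly Q x"
    and g: "\<And>x. poly S x \<noteq> 0 \<Longrightarrow> g x = poly R x / poly S x"
    using assms(1,2) by (elim rational_atE) blast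
  define T where "T = Q * S * (P * S - R * Q)"
  have "poly T x = 0" if "f x = g x" for x
    using that by (cases "poly Q x = 0 \<or> poly S x = 0") (auto simp: T_def f g frac_eq_eq)
  then have "{x. f x = g x} \<subseteq> {x. poly T x = 0}"
    by blast
  with inf have "T = 0"
    using poly_roots_finite finite_subset by blast
  then have "P * S = R * Q"
    using nz by (auto simp: T_def)
  then have "poly P a * poly S a = poly R a * poly Q a"
    by (metis poly_mult)
  then show ?thesis
    using nz by (simp add: f g frac_eq_eq)
qed

section \<open>The Gessel-Stanton sum\<close>

definition gs_term :: "'a::field_char_0 \<Rightarrow> 'a \<Rightarrow> 'a \<Rightarrow> nat \<Rightarrow> 'a" where
  "gs_term e n y k =
     pochhammer e k * pochhammer (- n) k * (\<Prod>j<k. (1/2 + of_nat j)\<^sup>2 - y) /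
     (fact k * pochhammer (1 + e + 2 * n) k * (\<Prod>j<k. (e + 3/2 + 2 * of_nat j)\<^sup>2 - y))"

definition gs_sum :: "'a::field_char_0 \<Rightarrow> 'a \<Rightarrow> 'a \<Rightarrow> nat \<Rightarrow> 'a" where
  "gs_sum e n y m = (\<Sum>k\<le>m. (3 * of_nat k + e) * gs_term e n y k)"

definition gs_denom :: "'a::field_char_0 \<Rightarrow> 'a \<Rightarrow> 'a \<Rightarrow> nat \<Rightarrow> 'a" where
  "gs_denom e n y k =
     (of_nat k + 1) * (1 + e + 2 * n + of_nat k) * ((e + 3/2 + 2 * of_nat k)\<^sup>2 - y)"

lemma gs_term_0 [simp]: "gs_term e n y 0 = 1"
  by (simp add: gs_term_def)

lemma gs_term_Suc:
  "gs_term e n y (Suc k) = gs_term e n y k *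
     ((e + of_nat k) * (of_nat k - n) * ((1/2 + of_nat k)\<^sup>2 - y) / gs_denom e n y k)"
  by (simp add: gs_term_def gs_denom_def pochhammer_Suc add.commute[of 1 "of_nat k"] mult_ac)

lemma gs_sum_0 [simp]: "gs_sum e n y 0 = e"
  by (simp add: gs_sum_def)

lemma gs_sum_Suc:
  "gs_sum e n y (Suc m) = gs_sum e n y m + (3 * of_nat (Suc m) + e) * gs_term e n y (Suc m)"
  by (simp add: gs_sum_def)

lemma gs_term_eq_0:
  assumes "(e + of_nat m) * (of_nat m - n) * ((1/2 + of_nat m)\<^sup>2 - y) = 0" and "m < k"
  shows "gs_term e n y k = 0"
  using assms(2) by (induction k) (use assms(1) in \<open>auto simp: gs_term_Suc less_Suc_eq\<close>)

lemma gs_sum_terminating: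
  assumes "(e + of_nat m) * (of_nat m - n) * ((1/2 + of_nat m)\<^sup>2 - y) = 0" and "m \<le> M"
  shows "gs_sum e n y M = gs_sum e n y m"
  unfolding gs_sum_def
  by (rule sum.mono_neutral_right) (use assms gs_term_eq_0[OF assms(1)] in auto)

lemma gs_term_function_subring:
  fixes A :: "('c \<Rightarrow> 'a::field_char_0) set"
  assumes "function_subring A" and "e \<in> A" "n \<in> A" "y \<in> A" and half: "(\<lambda>_. 1/2) \<in> A"
    and denom: "\<And>k. k < m \<Longrightarrow> (\<lambda>x. 1 / gs_denom (e x) (n x) (y x) k) \<in> A"
  shows "(\<lambda>x. gs_term (e x) (n x) (y x) m) \<in> A"
  using denom
proof (induction m)
  case 0
  then show ?case
    using assms(1) by (simp add: function_subring.one)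
next
  case (Suc m)
  interpret function_subring A by fact
  have "(\<lambda>x. gs_term (e x) (n x) (y x) m *
      ((e x + of_nat m) * (of_nat m - n x) * ((1/2 + of_nat m)\<^sup>2 - y x) *
       (1 / gs_denom (e x) (n x) (y x) m))) \<in> A"
    using Suc.IH Suc.prems assms(2-4) half by (intro closed) auto
  then show ?case
    by (simp add: gs_term_Suc)
qed

lemma gs_sum_function_subring:
  fixes A :: "('c \<Rightarrow> 'a::field_char_0) set"
  assumes "function_subring A" and "e \<in> A" "n \<in> A" "y \<in> A" and "(\<lambda>_. 1/2) \<in> A"
    and "\<And>k. k < m \<Longrightarrow> (\<lambda>x. 1 / gs_denom (e x) (n x) (y x) k) \<in> A"
  shows "(\<lambda>x. gs_sum (e x) (n x) (y x) m) \<in> A"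
proof -
  interpret function_subring A by fact
  show ?thesis
    unfolding gs_sum_def using assms by (intro closed gs_term_function_subring) auto
qed

lemma gs_sum_rational_at:
  assumes mem: "e \<in> rational_at a" "n \<in> rational_at a" "y \<in> rational_at a"
    and "\<And>k. k < m \<Longrightarrow> 1 + e a + 2 * n a + of_nat k \<noteq> 0"
    and "\<And>k. k < m \<Longrightarrow> (e a + 3/2 + 2 * of_nat k)\<^sup>2 \<noteq> y a"
  shows "(\<lambda>x. gs_sum (e x) (n x) (y x) m) \<in> rational_at a"
proof (rule gs_sum_function_subring)
  fix k assume "k < m"
  then have "gs_denom (e a) (n a) (y a) k \<noteq> 0"
    using assms of_nat_neq_0[where 'a = 'a, of k] by (simp add: gs_denom_def add.commute)
  moreover have "(\<lambda>x. gs_denom (e x) (n x) (y x) k) \<in> rational_at a"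
    unfolding gs_denom_def using mem by (intro rational_at.closed const_rational_at)
  ultimately show "(\<lambda>x. 1 / gs_denom (e x) (n x) (y x) k) \<in> rational_at a"
    by (intro inverse_rational_at)
qed (use mem in \<open>auto intro: const_rational_at rational_at.function_subring_axioms\<close>)

lemma gs_term_shift_n:
  assumes "\<And>j. 1 + e + 2 * n + of_nat j \<noteq> 0"
  shows "gs_term e (n + 1) y k *
      ((n + 1 - of_nat k) * (1 + e + 2 * n + of_nat k) * (2 + e + 2 * n + of_nat k))
    = gs_term e n y k * ((n + 1) * (1 + e + 2 * n) * (2 + e + 2 * n))"
proof (induction k)
  case 0
  show ?case by simp
next
  case (Suc k)
  define d where "d = 1 + e + 2 * n + of_nat k"
  define r where "r = (e + of_nat k) * ((1/2 + of_nat k)\<^sup>2 - y) /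
    ((of_nat k + 1) * ((e + 3/2 + 2 * of_nat k)\<^sup>2 - y))"
  define C where "C = (n + 1) * (1 + e + 2 * n) * (2 + e + 2 * n)"
  have d: "d \<noteq> 0" "d + 2 \<noteq> 0"
    using assms[of k] assms[of "k + 2"] by (simp_all add: d_def add_ac)
  have IH: "gs_term e (n + 1) y k * ((n + 1 - of_nat k) * d * (d + 1)) = gs_term e n y k * C"
    using Suc.IH by (simp add: d_def C_def add_ac)
  have shift: "1 + e + 2 * (n + 1) + of_nat k = d + 2"
    by (simp add: d_def)
  have "gs_term e (n + 1) y (Suc k) * (d + 2) = gs_term e (n + 1) y k * (r * (of_nat k - (n + 1)))"
    unfolding gs_term_Suc gs_denom_def r_def shift using d by simp
  then have "gs_term e (n + 1) y (Suc k) * ((n - of_nat k) * (d + 1) * (d + 2))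
      = gs_term e (n + 1) y k * (r * (of_nat k - (n + 1))) * ((n - of_nat k) * (d + 1))"
    by (simp only: mult_ac)
  also have "\<dots>
      = gs_term e (n + 1) y k * ((n + 1 - of_nat k) * d * (d + 1)) * (r * (of_nat k - n) / d)"
    using d by (simp add: field_simps)
  also have "\<dots> = gs_term e n y (Suc k) * C"
    unfolding IH by (simp add: gs_term_Suc gs_denom_def r_def d_def mult_ac)
  finally show ?case
    by (simp add: d_def C_def add_ac)
qed

text \<open>Multiplied by a summand, the two products on the right become consecutive boundary values.\<close>

lemma gs_sum_certificate:
  fixes e n y k :: "'a::field_char_0"
  shows "(3 * k + e) * (((e + 3/2 + 2 * n)\<^sup>2 - y) * (n + 1)
      - (n + 1 - k) * (1 + e + 2 * n + k) * (2 + e + 2 * n + k))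
   = (e + k) * (n + 1 - k) * ((1/2 + k)\<^sup>2 - y)
     + k * (2 + e + 2 * n + k) * ((e + 2 * k - 1/2)\<^sup>2 - y)"
  by (simp add: field_simps power2_eq_square)

lemma gs_term_contiguous:
  fixes e n y :: "'a::field_char_0"
  assumes "\<And>j. 1 + e + 2 * n + of_nat j \<noteq> 0"
  shows "(3 * of_nat k + e) * ((n + 1) * (((e + 3/2 + 2 * n)\<^sup>2 - y) * gs_term e (n + 1) y k
      - (1 + e + 2 * n) * (2 + e + 2 * n) * gs_term e n y k))
    = gs_term e (n + 1) y k * ((e + of_nat k) * (n + 1 - of_nat k) * ((1/2 + of_nat k)\<^sup>2 - y)
      + of_nat k * (2 + e + 2 * n + of_nat k) * ((e + 2 * of_nat k - 1/2)\<^sup>2 - y))"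
proof -
  define \<alpha> where "\<alpha> = (e + 3/2 + 2 * n)\<^sup>2 - y"
  define T where "T = gs_term e (n + 1) y k"
  have "(n + 1) * (\<alpha> * T - (1 + e + 2 * n) * (2 + e + 2 * n) * gs_term e n y k)
      = T * (\<alpha> * (n + 1)) - gs_term e n y k * ((n + 1) * (1 + e + 2 * n) * (2 + e + 2 * n))"
    by (simp only: right_diff_distrib mult_ac)
  also have "\<dots> = T * (\<alpha> * (n + 1)
      - (n + 1 - of_nat k) * (1 + e + 2 * n + of_nat k) * (2 + e + 2 * n + of_nat k))"
    unfolding gs_term_shift_n[OF assms, symmetric] T_def by (simp only: right_diff_distrib)
  finally show ?thesis
    unfolding gs_sum_certificate[symmetric] \<alpha>_def T_def by (simp only: mult_ac)
qed

lemma gs_term_boundary: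
  fixes e n y :: "'a::field_char_0"
  assumes "3 + e + 2 * n + of_nat m \<noteq> 0" and "(e + 3/2 + 2 * of_nat m)\<^sup>2 \<noteq> y"
  shows "gs_term e (n + 1) y m * ((e + of_nat m) * (n + 1 - of_nat m) * ((1/2 + of_nat m)\<^sup>2 - y))
    = - (gs_term e (n + 1) y (Suc m) * (of_nat (Suc m) * (2 + e + 2 * n + of_nat (Suc m)) *
        ((e + 2 * of_nat (Suc m) - 1/2)\<^sup>2 - y)))"
proof -
  have "e + 2 * of_nat (Suc m) - 1/2 = e + 3/2 + 2 * of_nat m"
    by (simp add: field_simps)
  then have "gs_term e (n + 1) y (Suc m) * (of_nat (Suc m) * (2 + e + 2 * n + of_nat (Suc m)) *
        ((e + 2 * of_nat (Suc m) - 1/2)\<^sup>2 - y))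
      = gs_term e (n + 1) y m * ((e + of_nat m) * (of_nat m - (n + 1)) * ((1/2 + of_nat m)\<^sup>2 - y))"
    using assms of_nat_neq_0[where 'a = 'a, of m]
    by (simp add: gs_term_Suc gs_denom_def add_ac)
  also have "\<dots> = - (gs_term e (n + 1) y m *
      ((e + of_nat m) * (n + 1 - of_nat m) * ((1/2 + of_nat m)\<^sup>2 - y)))"
    by (simp add: algebra_simps)
  finally show ?thesis
    by simp
qed

lemma gs_sum_contiguous:
  assumes linear: "\<And>j. 1 + e + 2 * n + of_nat j \<noteq> 0"
    and quadratic: "\<And>j. j < m \<Longrightarrow> (e + 3/2 + 2 * of_nat j)\<^sup>2 \<noteq> y"
  shows "(n + 1) * (((e + 3/2 + 2 * n)\<^sup>2 - y) * gs_sum e (n + 1) y m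
      - (1 + e + 2 * n) * (2 + e + 2 * n) * gs_sum e n y m)
    = gs_term e (n + 1) y m * ((e + of_nat m) * (n + 1 - of_nat m) * ((1/2 + of_nat m)\<^sup>2 - y))"
  using quadratic
proof (induction m)
  case 0
  show ?case by (simp add: field_simps power2_eq_square)
next
  case (Suc m)
  define \<alpha> where "\<alpha> = (e + 3/2 + 2 * n)\<^sup>2 - y"
  define \<gamma> where "\<gamma> = (1 + e + 2 * n) * (2 + e + 2 * n)"
  define B where "B = of_nat (Suc m) * (2 + e + 2 * n + of_nat (Suc m)) *
    ((e + 2 * of_nat (Suc m) - 1/2)\<^sup>2 - y)"
  define Q where "Q = (e + of_nat (Suc m)) * (n + 1 - of_nat (Suc m)) * ((1/2 + of_nat (Suc m))\<^sup>2 - y)"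
  have "3 + e + 2 * n + of_nat m \<noteq> 0"
    using linear[of "m + 2"] by (simp add: add_ac)
  then have IH: "(n + 1) * (\<alpha> * gs_sum e (n + 1) y m - \<gamma> * gs_sum e n y m)
      = - (gs_term e (n + 1) y (Suc m) * B)"
    using Suc gs_term_boundary[of e n m y] by (simp add: \<alpha>_def \<gamma>_def B_def)
  have "(n + 1) * (\<alpha> * gs_sum e (n + 1) y (Suc m) - \<gamma> * gs_sum e n y (Suc m))
      = (n + 1) * (\<alpha> * gs_sum e (n + 1) y m - \<gamma> * gs_sum e n y m)
        + (3 * of_nat (Suc m) + e) *
          ((n + 1) * (\<alpha> * gs_term e (n + 1) y (Suc m) - \<gamma> * gs_term e n y (Suc m)))"
    unfolding gs_sum_Suc by (simp add: algebra_simps)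
  also have "\<dots> = - (gs_term e (n + 1) y (Suc m) * B) + gs_term e (n + 1) y (Suc m) * (Q + B)"
    unfolding IH unfolding \<alpha>_def \<gamma>_def B_def Q_def gs_term_contiguous[OF linear] ..
  also have "\<dots> = gs_term e (n + 1) y (Suc m) * Q"
    by (simp add: distrib_left)
  finally show ?case
    by (simp only: \<alpha>_def \<gamma>_def Q_def)
qed

lemma gs_sum_of_nat_generic:
  assumes linear: "\<And>j. 1 + e + of_nat j \<noteq> 0"
    and quadratic: "\<And>j. j < n \<Longrightarrow> (e + 3/2 + 2 * of_nat j)\<^sup>2 \<noteq> y"
  shows "gs_sum e (of_nat n) y n
      = pochhammer e (2 * n + 1) / (\<Prod>j<n. (e + 3/2 + 2 * of_nat j)\<^sup>2 - y)"
  using quadratic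
proof (induction n)
  case 0
  show ?case by simp
next
  case (Suc n)
  define N where "N = (of_nat n :: 'a)"
  define S where "S k = gs_sum e (of_nat k) y k" for k
  define X where "X = (e + 3/2 + 2 * N)\<^sup>2 - y"
  have "X \<noteq> 0"
    using Suc.prems[of n] by (simp add: X_def N_def)
  have "N + 1 \<noteq> 0"
    using of_nat_neq_0[where 'a = 'a, of n] by (simp add: N_def add.commute)
  have "1 + e + 2 * N + of_nat j \<noteq> 0" for j
    using linear[of "2 * n + j"] by (simp add: N_def add_ac)
  then have "(N + 1) * (X * S (Suc n) - (1 + e + 2 * N) * (2 + e + 2 * N) * gs_sum e N y (Suc n))
      = 0"
    using gs_sum_contiguous[of e N "Suc n" y] Suc.prems
    by (simp add: N_def X_def S_def add.commute[of 1])
  moreover have "gs_sum e N y (Suc n) = S n"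
    unfolding S_def N_def by (rule gs_sum_terminating) simp_all
  ultimately have "X * S (Suc n) = (1 + e + 2 * N) * (2 + e + 2 * N) * S n"
    using \<open>N + 1 \<noteq> 0\<close> by simp
  then have "S (Suc n) = S n * ((1 + e + 2 * N) * (2 + e + 2 * N)) / X"
    using \<open>X \<noteq> 0\<close> by (simp add: eq_divide_eq mult_ac)
  moreover have "pochhammer e (2 * Suc n + 1)
      = pochhammer e (2 * n + 1) * ((1 + e + 2 * N) * (2 + e + 2 * N))"
    by (simp add: pochhammer_Suc N_def add_ac mult_ac)
  ultimately show ?case
    using Suc by (simp add: S_def X_def N_def)
qed

theorem gs_sum_of_nat:
  fixes e y :: "'a::linordered_field"
  assumes "\<And>k. k < n \<Longrightarrow> 1 + e + 2 * of_nat n + of_nat k \<noteq> 0"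
    and "\<And>j. j < n \<Longrightarrow> (e + 3/2 + 2 * of_nat j)\<^sup>2 \<noteq> y"
  shows "gs_sum e (of_nat n) y n
      = pochhammer e (2 * n + 1) / (\<Prod>j<n. (e + 3/2 + 2 * of_nat j)\<^sup>2 - y)"
proof -
  define f where "f x = gs_sum x (of_nat n) y n" for x
  define g where "g x = pochhammer x (2 * n + 1) * (1 / (\<Prod>j<n. (x + 3/2 + 2 * of_nat j)\<^sup>2 - y))"
    for x
  have "f x = g x" if "x \<ge> 1 + \<bar>y\<bar>" for x
    unfolding f_def g_def times_divide_eq_right mult_1_right
  proof (rule gs_sum_of_nat_generic)
    fix j :: nat
    have x: "x \<ge> 1" "y < x" using that by linarith+
    then show "1 + x + of_nat j \<noteq> 0"
      using add_pos_nonneg[of "1 + x" "of_nat j"] by simp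
    have "y < x * 1" using x by simp
    also have "\<dots> \<le> x * x" using x by (intro mult_left_mono) auto
    also have "\<dots> \<le> (x + 3/2 + 2 * of_nat j)\<^sup>2"
      unfolding power2_eq_square using x by (intro mult_mono) (auto simp: add.assoc)
    finally show "(x + 3/2 + 2 * of_nat j)\<^sup>2 \<noteq> y" by simp
  qed
  then have "{1 + \<bar>y\<bar>..} \<subseteq> {x. f x = g x}"
    by auto
  then have "infinite {x. f x = g x}"
    using infinite_Ici finite_subset by blast
  moreover have "f \<in> rational_at e"
    unfolding f_def using assms
    by (intro gs_sum_rational_at ident_rational_at const_rational_at)
  moreover have "g \<in> rational_at e"
    unfolding g_def using assms(2)
    by (intro rational_at.closed inverse_rational_at ident_rational_at const_rational_at) simp
  ultimately have "f e = g e"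
    by (intro rational_at_eqI)
  then show ?thesis
    by (simp add: f_def g_def)
qed

corollary gs_sum_half_of_nat:
  fixes y :: "'a::linordered_field"
  assumes "\<And>j. j < n \<Longrightarrow> (2 * of_nat (Suc j))\<^sup>2 \<noteq> y"
  shows "gs_sum (1/2) (of_nat n) y n
      = pochhammer (1/2) (2 * n + 1) / (\<Prod>j<n. (2 * of_nat (Suc j))\<^sup>2 - y)"
proof -
  have eq: "1/2 + 3/2 + 2 * of_nat j = (2 * of_nat (Suc j) :: 'a)" for j
    by simp
  have "1 + 1/2 + 2 * of_nat n + of_nat k \<noteq> (0 :: 'a)" for k
  proof -
    have "0 < (1 + 1/2 + of_nat (2 * n + k) :: 'a)"
      by (intro add_pos_nonneg) simp_all
    then show ?thesis by (simp add: add_ac)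
  qed
  then show ?thesis
    using gs_sum_of_nat[of n "1/2" y] assms unfolding eq by blast
qed

corollary gs_sum_neg_of_nat:
  fixes y :: "'a::linordered_field"
  assumes "m \<le> n" and "\<And>j. j < n \<Longrightarrow> (3/2 - of_nat m + 2 * of_nat j)\<^sup>2 \<noteq> y"
  shows "gs_sum (- of_nat m) (of_nat n) y m = 0"
proof -
  have "gs_sum (- of_nat m) (of_nat n) y m = gs_sum (- of_nat m) (of_nat n) y n"
    by (rule gs_sum_terminating[symmetric]) (use assms(1) in simp_all)
  also have "\<dots> = pochhammer (- of_nat m) (2 * n + 1) /
      (\<Prod>j<n. (- of_nat m + 3/2 + 2 * of_nat j)\<^sup>2 - y)"
  proof (rule gs_sum_of_nat)
    fix k
    have "1 + - of_nat m + 2 * of_nat n + of_nat k = (of_nat (Suc (2 * n + k - m)) :: 'a)"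
      using assms(1) by (simp add: of_nat_diff)
    then show "1 + - of_nat m + 2 * of_nat n + of_nat k \<noteq> (0 :: 'a)"
      by (metis of_nat_neq_0)
  qed (use assms(2) in \<open>simp add: add_ac\<close>)
  also have "\<dots> = 0"
    using assms(1) by (simp add: pochhammer_of_nat_eq_0_lemma del: pochhammer_Suc)
  finally show ?thesis .
qed

text \<open>
  The product of \<open>(u - i) / (u + i + 1)\<close> over the \<open>i < m\<close> with \<open>m - i\<close> odd; up to a constant factor,
  \<open>\<Gamma>(u + 1) / (2\<^sup>u \<Gamma>(u/2 + 1 + m/2) \<Gamma>(u/2 + 1/2 - m/2))\<close>.
\<close>

fun gs_ratio :: "nat \<Rightarrow> 'a::field_char_0 \<Rightarrow> 'a" where
  "gs_ratio 0 u = 1"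
| "gs_ratio (Suc 0) u = u / (u + 1)"
| "gs_ratio (Suc (Suc m)) u = gs_ratio m u * ((u - of_nat m - 1) / (u + of_nat m + 2))"

lemma add_of_int_neq_0: "u \<notin> \<int> \<Longrightarrow> u + of_int i \<noteq> (0 :: 'a::ring_1)"
  by (metis Ints_minus Ints_of_int add_eq_0_iff2)

lemma gs_ratio_nonzero:
  assumes "u \<notin> \<int>"
  shows "gs_ratio m u \<noteq> 0"
proof (induction m rule: induct_nat_012)
  case 1
  show ?case
    using add_of_int_neq_0[OF assms, of 0] add_of_int_neq_0[OF assms, of 1] by simp
next
  case (ge2 m)
  have "u - of_nat m - 1 \<noteq> 0" "u + of_nat m + 2 \<noteq> 0"
    using add_of_int_neq_0[OF assms, of "- int m - 1"] add_of_int_neq_0[OF assms, of "int m + 2"]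
    by (simp_all add: algebra_simps)
  then show ?case
    using ge2 by simp
qed simp

lemma gs_ratio_add_2:
  assumes "u \<notin> \<int>"
  shows "gs_ratio m (u + 2) * ((u + of_nat m + 2) * (u - of_nat m + 1))
      = gs_ratio m u * ((u + 1) * (u + 2))"
proof (induction m rule: induct_nat_012)
  case 0
  show ?case by (simp add: mult_ac)
next
  case 1
  have "u + 1 \<noteq> 0" "u + 3 \<noteq> 0"
    using add_of_int_neq_0[OF assms, of 1] add_of_int_neq_0[OF assms, of 3] by simp_all
  then show ?case by (simp add: field_simps)
next
  case (ge2 m)
  define a where "a = u + of_nat m"
  define b where "b = u - of_nat m"
  have nz: "a + 2 \<noteq> 0" "a + 4 \<noteq> 0"
    using add_of_int_neq_0[OF assms, of "int m + 2"] add_of_int_neq_0[OF assms, of "int m + 4"]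
    by (simp_all add: a_def add_ac)
  have "gs_ratio (Suc (Suc m)) (u + 2) * ((u + of_nat (Suc (Suc m)) + 2) * (u - of_nat (Suc (Suc m)) + 1))
      = gs_ratio m (u + 2) * ((b + 1) / (a + 4)) * ((a + 4) * (b - 1))"
    by (simp add: a_def b_def algebra_simps)
  also have "\<dots> = gs_ratio m (u + 2) * ((a + 2) * (b + 1)) * ((b - 1) / (a + 2))"
    using nz by simp
  also have "\<dots> = gs_ratio m u * ((b - 1) / (a + 2)) * ((u + 1) * (u + 2))"
    unfolding a_def b_def ge2.IH(1) by simp
  finally show ?case
    by (simp add: a_def b_def)
qed

lemma gs_ratio_minus_half:
  "gs_ratio m (- 1/2) = (-1) ^ m * of_nat (2 * m + 1) * gs_ratio m (1/2 :: 'a::field_char_0)"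
proof (induction m rule: induct_nat_012)
  case (ge2 m)
  define b c d :: 'a
    where "b = of_nat (2 * m + 1)" and "c = of_nat (2 * m + 3)" and "d = of_nat (2 * m + 5)"
  have nz: "c \<noteq> 0" "d \<noteq> 0"
    unfolding c_def d_def of_nat_eq_0_iff by simp_all
  have eqs: "- 1/2 - of_nat m - 1 = - (c / 2)" "- 1/2 + of_nat m + 2 = c / 2"
    "1/2 - of_nat m - 1 = - (b / 2)" "1/2 + of_nat m + 2 = d / 2"
    by (simp_all add: b_def c_def d_def field_simps)
  have "gs_ratio (Suc (Suc m)) (- 1/2) = - gs_ratio m (- 1/2 :: 'a)"
    unfolding gs_ratio.simps eqs using nz by simp
  also have "\<dots> = (-1) ^ m * (- b * gs_ratio m (1/2))"
    unfolding ge2.IH(1) b_def[symmetric] by simp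
  also have "- b * gs_ratio m (1/2) = d * gs_ratio (Suc (Suc m)) (1/2)"
    unfolding gs_ratio.simps eqs using nz by simp
  also have "d = of_nat (2 * Suc (Suc m) + 1)"
    by (simp add: d_def)
  finally show ?case
    by (simp add: mult.assoc)
qed simp_all

lemma gs_ratio_rational_at:
  assumes "f \<in> rational_at a" and "\<And>k. k < m \<Longrightarrow> f a + of_nat k + 1 \<noteq> 0"
  shows "(\<lambda>x. gs_ratio m (f x)) \<in> rational_at a"
  using assms(2)
proof (induction m rule: induct_nat_012)
  case (ge2 m)
  have "(\<lambda>x. gs_ratio m (f x) * ((f x - of_nat m - 1) * (1 / (f x + of_nat m + 2)))) \<in> rational_at a"
    using ge2 assms(1) ge2.prems[of "Suc m"]
    by (intro rational_at.closed inverse_rational_at) (auto simp: add_ac)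
  then show ?case by simp
next
  case 1
  have "(\<lambda>x. f x * (1 / (f x + 1))) \<in> rational_at a"
    using assms(1) 1 by (intro rational_at.closed inverse_rational_at) auto
  then show ?case by simp
qed (simp add: rational_at.one)

lemma half_odd_factor:
  "(e + 3/2 + 2 * of_nat j)\<^sup>2 - (of_nat m + 1/2)\<^sup>2
    = (e + 2 * of_nat j + of_nat m + 2) * (e + 2 * of_nat j - of_nat m + 1)"
  for e :: "'a::field_char_0"
  by (simp add: field_simps power2_eq_square)

lemma half_odd_neq:
  fixes e :: "'a::field_char_0"
  assumes "e \<notin> \<int>"
  shows "(e + 3/2 + 2 * of_nat j)\<^sup>2 \<noteq> (of_nat m + 1/2)\<^sup>2"
proof -
  have "e + 2 * of_nat j + of_nat m + 2 \<noteq> 0" "e + 2 * of_nat j - of_nat m + 1 \<noteq> 0"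
    using add_of_int_neq_0[OF assms, of "2 * int j + int m + 2"]
      add_of_int_neq_0[OF assms, of "2 * int j - int m + 1"]
    by (simp_all add: algebra_simps)
  then show ?thesis
    using half_odd_factor[of e j m] by (metis eq_iff_diff_eq_0 mult_eq_0_iff)
qed

lemma gs_sum_of_nat_half_odd:
  fixes e :: "'a::linordered_field"
  assumes nonint: "e \<notin> \<int>"
  shows "gs_ratio m e * gs_sum e (of_nat n) ((of_nat m + 1/2)\<^sup>2) n
      = e * gs_ratio m (e + 2 * of_nat n)"
proof -
  define y :: 'a where "y = (of_nat m + 1/2)\<^sup>2"
  have notin: "e + 2 * of_nat j \<notin> \<int>" for j :: nat
    using nonint by (metis Ints_diff Ints_mult Ints_numeral Ints_of_nat add_diff_cancel_right')
  have "gs_ratio m e * pochhammer e (2 * n + 1)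
      = e * gs_ratio m (e + 2 * of_nat n) * (\<Prod>j<n. (e + 3/2 + 2 * of_nat j)\<^sup>2 - y)"
  proof (induction n)
    case (Suc n)
    define u where "u = e + 2 * of_nat n"
    have "gs_ratio m e * pochhammer e (2 * Suc n + 1)
        = gs_ratio m e * pochhammer e (2 * n + 1) * ((u + 1) * (u + 2))"
      by (simp add: pochhammer_Suc u_def add_ac mult_ac)
    also have "\<dots>
        = e * (\<Prod>j<n. (e + 3/2 + 2 * of_nat j)\<^sup>2 - y) * (gs_ratio m u * ((u + 1) * (u + 2)))"
      unfolding Suc.IH u_def by (simp only: mult_ac)
    also have "gs_ratio m u * ((u + 1) * (u + 2))
        = gs_ratio m (u + 2) * ((e + 3/2 + 2 * of_nat n)\<^sup>2 - y)"
      unfolding u_def y_def half_odd_factor gs_ratio_add_2[OF notin, symmetric] ..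
    also have "u + 2 = e + 2 * of_nat (Suc n)"
      by (simp add: u_def)
    finally show ?case
      by (simp only: prod.lessThan_Suc mult_ac)
  qed simp
  moreover have "1 + e + 2 * of_nat n + of_nat k \<noteq> 0" for k
    using add_of_int_neq_0[OF nonint, of "1 + 2 * int n + int k"] by (simp add: add_ac)
  ultimately show ?thesis
    using half_odd_neq[OF nonint]
    by (simp add: gs_sum_of_nat y_def divide_eq_eq del: pochhammer_Suc)
qed

theorem gs_sum_half_odd:
  fixes e n :: "'a::linordered_field"
  assumes nonint: "e \<notin> \<int>" and linear: "\<And>k. k < m \<Longrightarrow> 1 + e + 2 * n + of_nat k \<noteq> 0"
  shows "gs_ratio m e * gs_sum e n ((of_nat m + 1/2)\<^sup>2) m = e * gs_ratio m (e + 2 * n)"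
proof -
  define y :: 'a where "y = (of_nat m + 1/2)\<^sup>2"
  define f where "f x = gs_ratio m e * gs_sum e x y m" for x
  define g where "g x = e * gs_ratio m (e + 2 * x)" for x
  have "f (of_nat N) = g (of_nat N)" if "N \<ge> m" for N
  proof -
    have "gs_sum e (of_nat N) y m = gs_sum e (of_nat N) y N"
      by (rule gs_sum_terminating[symmetric]) (use that in \<open>simp_all add: y_def add.commute\<close>)
    then show ?thesis
      using gs_sum_of_nat_half_odd[OF nonint, of m N] by (simp add: f_def g_def y_def)
  qed
  then have "of_nat ` {m..} \<subseteq> {x. f x = g x}"
    by auto
  moreover have "infinite (of_nat ` {m..} :: 'a set)"
    by (simp add: finite_image_iff inj_on_def infinite_Ici)
  ultimately have "infinite {x. f x = g x}"
    using finite_subset by blast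
  moreover have "f \<in> rational_at n"
    unfolding f_def y_def using linear half_odd_neq[OF nonint]
    by (intro rational_at.mult const_rational_at gs_sum_rational_at ident_rational_at)
  moreover have "g \<in> rational_at n"
    unfolding g_def
    using linear
    by (intro rational_at.closed const_rational_at gs_ratio_rational_at ident_rational_at)
      (simp add: add_ac)
  ultimately have "f n = g n"
    by (intro rational_at_eqI)
  then show ?thesis
    by (simp add: f_def g_def y_def)
qed

corollary gs_sum_half_minus_half:
  "gs_sum (1/2) (- 1/2) ((of_nat m + 1/2)\<^sup>2) m
      = (-1) ^ m * of_nat (2 * m + 1) / (2 :: 'a::linordered_field)"
proof -
  have half: "(1/2 :: 'a) \<notin> \<int>"
    using fraction_not_in_Ints[of 2 1, where 'a = 'a] by simp
  have "gs_ratio m (1/2) * gs_sum (1/2) (- 1/2) ((of_nat m + 1/2)\<^sup>2) m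
      = 1/2 * gs_ratio m (1/2 + 2 * (- 1/2) :: 'a)"
  proof (rule gs_sum_half_odd[OF half])
    show "1 + 1/2 + 2 * (- 1/2) + of_nat k \<noteq> (0 :: 'a)" for k
      using add_of_int_neq_0[OF half, of "int k"] by simp
  qed
  also have "1/2 + 2 * (- 1/2) = (- 1/2 :: 'a)"
    by simp
  finally show ?thesis
    using gs_ratio_nonzero[OF half, of m] unfolding gs_ratio_minus_half by simp
qed

section \<open>Congruences in the localisation\<close>

lemma sum_pair_reflected:
  fixes f :: "nat \<Rightarrow> 'a::comm_monoid_add"
  assumes c: "c = 1 \<or> c = 2"
  shows "(\<Sum>i=1..2*m. f i) = (\<Sum>j=1..m. f (c * j)) + (\<Sum>j=1..m. f (2 * m + 1 - c * j))"
proof -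
  let ?A = "(\<lambda>j. c * j) ` {1..m}" and ?B = "(\<lambda>j. 2 * m + 1 - c * j) ` {1..m}"
  have inj: "inj_on (\<lambda>j. c * j) {1..m}" "inj_on (\<lambda>j. 2 * m + 1 - c * j) {1..m}"
    using c by (auto simp: inj_on_def)
  have disjoint: "?A \<inter> ?B = {}"
    using c by auto presburger
  have "{1..2*m} = ?A \<union> ?B"
  proof (rule sym, rule card_subset_eq)
    show "?A \<union> ?B \<subseteq> {1..2*m}"
      using c by auto
    show "card (?A \<union> ?B) = card {1..2*m}"
      using disjoint inj by (simp add: card_Un_disjoint card_image)
  qed simp
  then have "(\<Sum>i=1..2*m. f i) = sum f ?A + sum f ?B"
    using disjoint by (simp only:) (simp add: sum.union_disjoint)
  then show ?thesis
    by (simp only: sum.reindex[OF inj(1)] sum.reindex[OF inj(2)] o_def)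
qed

locale localization_at_prime =
  fixes p :: nat
  assumes prime_p: "prime p"
begin

lemma prime_int_p: "prime (int p)"
  using prime_p by simp

lemma Z_locI: "\<not> int p dvd b \<Longrightarrow> of_int a / of_int b \<in> Z_loc p"
  unfolding Z_loc_def by blast

lemma Z_locE:
  assumes "x \<in> Z_loc p"
  obtains a b where "x = of_int a / of_int b" "\<not> int p dvd b" "b \<noteq> 0"
  using assms unfolding Z_loc_def by force

lemma Z_loc_of_int: "of_int a \<in> Z_loc p"
  using Z_locI[of 1 a] prime_p by (auto simp: prime_nat_iff)

lemma Z_loc_of_nat: "of_nat a \<in> Z_loc p"
  using Z_loc_of_int[of "int a"] by simp

lemma Z_loc_numeral: "numeral a \<in> Z_loc p" "0 \<in> Z_loc p" "1 \<in> Z_loc p"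
  using Z_loc_of_int[of "numeral a"] Z_loc_of_int[of 0] Z_loc_of_int[of 1] by simp_all

lemma Z_loc_of_bool: "of_bool P \<in> Z_loc p"
  by (cases P) (simp_all add: Z_loc_numeral)

lemma Z_loc_add:
  assumes "x \<in> Z_loc p" "y \<in> Z_loc p"
  shows "x + y \<in> Z_loc p"
proof -
  obtain a b c d where "x = of_int a / of_int b" "\<not> int p dvd b" "b \<noteq> 0"
      and "y = of_int c / of_int d" "\<not> int p dvd d" "d \<noteq> 0"
    using assms by (elim Z_locE)
  then show ?thesis
    using Z_locI[of "b * d" "a * d + c * b"]
    by (simp add: prime_dvd_mult_iff[OF prime_int_p] add_frac_eq)
qed

lemma Z_loc_mult:
  assumes "x \<in> Z_loc p" "y \<in> Z_loc p"
  shows "x * y \<in> Z_loc p"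
proof -
  obtain a b c d where "x = of_int a / of_int b" "\<not> int p dvd b"
      and "y = of_int c / of_int d" "\<not> int p dvd d"
    using assms by (elim Z_locE)
  then show ?thesis
    using Z_locI[of "b * d" "a * c"] by (simp add: prime_dvd_mult_iff[OF prime_int_p])
qed

lemma Z_loc_minus: "x \<in> Z_loc p \<Longrightarrow> - x \<in> Z_loc p"
  using Z_loc_mult[OF Z_loc_of_int[of "- 1"], of x] by simp

lemma Z_loc_diff: "x \<in> Z_loc p \<Longrightarrow> y \<in> Z_loc p \<Longrightarrow> x - y \<in> Z_loc p"
  using Z_loc_add[of x "- y"] Z_loc_minus[of y] by simp

lemma Z_loc_power: "x \<in> Z_loc p \<Longrightarrow> x ^ k \<in> Z_loc p"
  by (induction k) (simp_all add: Z_loc_mult Z_loc_numeral)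

lemma Z_loc_sum: "(\<And>i. i \<in> I \<Longrightarrow> f i \<in> Z_loc p) \<Longrightarrow> sum f I \<in> Z_loc p"
  by (induction I rule: infinite_finite_induct) (simp_all add: Z_loc_add Z_loc_numeral)

lemma Z_loc_prod: "(\<And>i. i \<in> I \<Longrightarrow> f i \<in> Z_loc p) \<Longrightarrow> prod f I \<in> Z_loc p"
  by (induction I rule: infinite_finite_induct) (simp_all add: Z_loc_mult Z_loc_numeral)

lemmas Z_loc_closed =
  Z_loc_of_nat Z_loc_numeral Z_loc_of_bool Z_loc_add Z_loc_mult Z_loc_minus Z_loc_diff
  Z_loc_power Z_loc_sum Z_loc_prod

definition Z_loc_units :: "rat set" where
  "Z_loc_units = {of_int a / of_int b | a b. \<not> int p dvd a \<and> \<not> int p dvd b}"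

lemma Z_loc_unitsI: "\<not> int p dvd a \<Longrightarrow> \<not> int p dvd b \<Longrightarrow> of_int a / of_int b \<in> Z_loc_units"
  unfolding Z_loc_units_def by blast

lemma Z_loc_unitsE:
  assumes "x \<in> Z_loc_units"
  obtains a b where "x = of_int a / of_int b" "\<not> int p dvd a" "\<not> int p dvd b" "a \<noteq> 0" "b \<noteq> 0"
  using assms unfolding Z_loc_units_def by force

lemma Z_loc_units_nonzero: "x \<in> Z_loc_units \<Longrightarrow> x \<noteq> 0"
  by (auto elim!: Z_loc_unitsE)

lemma Z_loc_units_in_Z_loc: "x \<in> Z_loc_units \<Longrightarrow> x \<in> Z_loc p"
  by (auto elim!: Z_loc_unitsE intro: Z_locI)

lemma Z_loc_units_inverse: "x \<in> Z_loc_units \<Longrightarrow> 1 / x \<in> Z_loc_units"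
  by (auto elim!: Z_loc_unitsE intro: Z_loc_unitsI)

lemma Z_loc_inverse_unit: "x \<in> Z_loc_units \<Longrightarrow> 1 / x \<in> Z_loc p"
  by (intro Z_loc_units_in_Z_loc Z_loc_units_inverse)

lemma Z_loc_units_mult:
  assumes "x \<in> Z_loc_units" "y \<in> Z_loc_units"
  shows "x * y \<in> Z_loc_units"
proof -
  obtain a b c d where "x = of_int a / of_int b" "\<not> int p dvd a" "\<not> int p dvd b"
      and "y = of_int c / of_int d" "\<not> int p dvd c" "\<not> int p dvd d"
    using assms by (elim Z_loc_unitsE)
  then show ?thesis
    using Z_loc_unitsI[of "a * c" "b * d"] by (simp add: prime_dvd_mult_iff[OF prime_int_p])
qed

lemma Z_loc_units_of_nat:
  assumes "0 < a" "a < p"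
  shows "of_nat a \<in> Z_loc_units"
proof -
  have "\<not> int p dvd int a"
    using assms by (auto dest: dvd_imp_le)
  moreover have "\<not> int p dvd 1"
    using prime_p by (auto simp: prime_nat_iff)
  ultimately show ?thesis
    using Z_loc_unitsI[of "int a" 1] by simp
qed

lemma Z_loc_units_numeral: "numeral a < p \<Longrightarrow> numeral a \<in> Z_loc_units"
  using Z_loc_units_of_nat[of "numeral a"] by simp

lemma Z_loc_units_one: "1 \<in> Z_loc_units"
  using Z_loc_units_of_nat[of 1] prime_gt_1_nat[OF prime_p] by simp

lemma Z_loc_units_power: "x \<in> Z_loc_units \<Longrightarrow> x ^ k \<in> Z_loc_units"
  by (induction k) (simp_all add: Z_loc_units_mult Z_loc_units_one)

lemma Z_loc_units_prod: "(\<And>i. i \<in> I \<Longrightarrow> f i \<in> Z_loc_units) \<Longrightarrow> prod f I \<in> Z_loc_units"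
  by (induction I rule: infinite_finite_induct) (simp_all add: Z_loc_units_mult Z_loc_units_one)

lemma rat_cong_iff: "rat_cong x y p m \<longleftrightarrow> (\<exists>z\<in>Z_loc p. x - y = of_nat p ^ m * z)"
  by (auto simp: rat_cong_def)

lemma rat_congI: "x = y + of_nat p ^ m * z \<Longrightarrow> z \<in> Z_loc p \<Longrightarrow> rat_cong x y p m"
  by (auto simp: rat_cong_iff)

lemma rat_congE:
  assumes "rat_cong x y p m"
  obtains z where "z \<in> Z_loc p" "x = y + of_nat p ^ m * z"
  using assms by (auto simp: rat_cong_iff algebra_simps)

lemma rat_cong_refl: "rat_cong x x p m"
  by (rule rat_congI[of _ _ _ 0]) (simp_all add: Z_loc_closed)

lemma rat_cong_mult_left:
  assumes "rat_cong x y p m" and "c \<in> Z_loc p"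
  shows "rat_cong (c * x) (c * y) p m"
proof -
  obtain z where "z \<in> Z_loc p" "x = y + of_nat p ^ m * z"
    using assms(1) by (rule rat_congE)
  then show ?thesis
    using assms(2) by (intro rat_congI[of _ _ _ "c * z"]) (simp_all add: Z_loc_closed distrib_left)
qed

lemma rat_cong_sym:
  assumes "rat_cong x y p m"
  shows "rat_cong y x p m"
proof -
  obtain z where "z \<in> Z_loc p" "x = y + of_nat p ^ m * z"
    using assms by (rule rat_congE)
  then show ?thesis
    by (intro rat_congI[of _ _ _ "- z"]) (simp_all add: Z_loc_closed)
qed

lemma rat_cong_add:
  assumes "rat_cong x y p m" "rat_cong u v p m"
  shows "rat_cong (x + u) (y + v) p m"
proof -
  obtain a b where "a \<in> Z_loc p" "x = y + of_nat p ^ m * a" "b \<in> Z_loc p" "u = v + of_nat p ^ m * b"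
    using assms by (elim rat_congE)
  then show ?thesis
    by (intro rat_congI[of _ _ _ "a + b"]) (simp_all add: Z_loc_closed algebra_simps)
qed

lemma rat_cong_trans [trans]: "rat_cong x y p m \<Longrightarrow> rat_cong y z p m \<Longrightarrow> rat_cong x z p m"
  using rat_cong_add[of x y m y z] by (simp add: rat_cong_iff)

lemma rat_cong_mult:
  assumes "rat_cong x y p m" "rat_cong u v p m" and "y \<in> Z_loc p" "u \<in> Z_loc p"
  shows "rat_cong (x * u) (y * v) p m"
proof -
  have "rat_cong (u * x) (u * y) p m" "rat_cong (y * u) (y * v) p m"
    using assms by (simp_all add: rat_cong_mult_left)
  then show ?thesis
    by (metis mult.commute rat_cong_trans)
qed

lemma rat_cong_diff:
  "rat_cong x y p m \<Longrightarrow> rat_cong u v p m \<Longrightarrow> rat_cong (x - u) (y - v) p m"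
  using rat_cong_add[of x y m "- u" "- v"] rat_cong_mult_left[of u v m "- 1"]
  by (simp add: Z_loc_closed)

lemma rat_cong_mono:
  assumes "rat_cong x y p n" and "m \<le> n"
  shows "rat_cong x y p m"
proof -
  obtain z where "z \<in> Z_loc p" "x = y + of_nat p ^ n * z"
    using assms(1) by (rule rat_congE)
  moreover have "(of_nat p ^ n :: rat) = of_nat p ^ m * of_nat p ^ (n - m)"
    using assms(2) by (simp flip: power_add)
  ultimately show ?thesis
    by (intro rat_congI[of _ _ _ "of_nat p ^ (n - m) * z"]) (simp_all add: Z_loc_closed mult.assoc)
qed

lemma rat_cong_sum:
  "(\<And>i. i \<in> I \<Longrightarrow> rat_cong (f i) (g i) p m) \<Longrightarrow> rat_cong (sum f I) (sum g I) p m"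
  by (induction I rule: infinite_finite_induct) (simp_all add: rat_cong_refl rat_cong_add)

lemma rat_cong_Z_loc: "rat_cong x y p m \<Longrightarrow> y \<in> Z_loc p \<Longrightarrow> x \<in> Z_loc p"
  by (auto elim!: rat_congE simp: Z_loc_closed)

lemma rat_cong_power:
  assumes "rat_cong x y p m" and "y \<in> Z_loc p"
  shows "rat_cong (x ^ k) (y ^ k) p m"
  using rat_cong_Z_loc[OF assms] assms(2)
  by (induction k) (simp_all add: rat_cong_refl rat_cong_mult Z_loc_closed assms(1))

lemma rat_cong_mult_left_cong_0:
  assumes "rat_cong a 0 p i" and "rat_cong x y p j"
  shows "rat_cong (a * x) (a * y) p (i + j)"
proof -
  obtain b z where "b \<in> Z_loc p" "a = of_nat p ^ i * b" "z \<in> Z_loc p" "x = y + of_nat p ^ j * z"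
    using assms by (elim rat_congE) simp
  then show ?thesis
    by (intro rat_congI[of _ _ _ "b * z"]) (simp_all add: Z_loc_closed algebra_simps power_add)
qed

lemma rat_cong_inverse:
  assumes "rat_cong x y p m" and "x \<in> Z_loc_units" "y \<in> Z_loc_units"
  shows "rat_cong (1 / x) (1 / y) p m"
proof -
  have "rat_cong (1 / x * (1 / y) * y) (1 / x * (1 / y) * x) p m"
    using assms
    by (intro rat_cong_mult_left rat_cong_sym[OF assms(1)] Z_loc_mult Z_loc_inverse_unit)
  then show ?thesis
    using assms(2,3)[THEN Z_loc_units_nonzero] by simp
qed

lemma rat_cong_unit:
  assumes "rat_cong x y p 1" and "y \<in> Z_loc_units"
  shows "x \<in> Z_loc_units"
proof -
  obtain z where "z \<in> Z_loc p" and x: "x = y + of_nat p * z"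
    using assms(1) by (auto elim: rat_congE)
  then obtain a b c d where y: "y = of_int a / of_int b" "\<not> int p dvd a" "\<not> int p dvd b" "b \<noteq> 0"
      and z: "z = of_int c / of_int d" "\<not> int p dvd d" "d \<noteq> 0"
    using assms(2) by (elim Z_locE Z_loc_unitsE)
  have "x = of_int (a * d + int p * (c * b)) / of_int (b * d)"
    unfolding x y(1) z(1) using y(4) z(3) by (simp add: field_simps)
  moreover have "\<not> int p dvd a * d + int p * (c * b)" "\<not> int p dvd b * d"
    using y z by (simp_all add: dvd_add_left_iff prime_dvd_mult_iff[OF prime_int_p])
  ultimately show ?thesis
    by (simp only: Z_loc_unitsI not_False_eq_True)
qed

lemma inverse_square_reflect:
  assumes "0 < i" "i < p"
  shows "rat_cong (1 / (of_nat (p - i))\<^sup>2) (1 / (of_nat i)\<^sup>2) p 1"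
proof -
  have "rat_cong (of_nat (p - i)) (- of_nat i) p 1"
    using assms by (intro rat_congI[of _ _ _ 1]) (simp_all add: of_nat_diff Z_loc_closed)
  then have "rat_cong ((of_nat (p - i))\<^sup>2) ((- of_nat i)\<^sup>2) p 1"
    by (rule rat_cong_power) (intro Z_loc_closed)+
  then show ?thesis
    using assms by (intro rat_cong_inverse Z_loc_units_power Z_loc_units_of_nat) simp_all
qed

text \<open>
  Modulo \<open>p\<close>, pairing \<open>i\<close> with \<open>p - i\<close> shows that the sum over all \<open>0 < i < p\<close> is twice the half
  sum \<open>T\<close>, and pairing \<open>2j\<close> with \<open>p - 2j\<close> shows that it is \<open>T/2\<close>.
\<close>

lemma sum_inverse_squares_cong_0:
  assumes m: "p = 2 * m + 1" and "p > 3"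
  shows "rat_cong (\<Sum>j=1..m. 1 / (of_nat j)\<^sup>2) 0 p 1"
proof -
  define T :: rat where "T = (\<Sum>j=1..m. 1 / (of_nat j)\<^sup>2)"
  define U :: rat where "U = (\<Sum>i=1..2*m. 1 / (of_nat i)\<^sup>2)"
  have reflect: "rat_cong U ((\<Sum>j=1..m. 1 / (of_nat (c * j))\<^sup>2) + (\<Sum>j=1..m. 1 / (of_nat (c * j))\<^sup>2)) p 1"
    if c: "c = 1 \<or> c = 2" for c
  proof -
    have "rat_cong (\<Sum>j=1..m. 1 / (of_nat (2 * m + 1 - c * j))\<^sup>2) (\<Sum>j=1..m. 1 / (of_nat (c * j))\<^sup>2) p 1"
      unfolding m[symmetric] using c m by (intro rat_cong_sum inverse_square_reflect) auto
    then show ?thesis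
      unfolding U_def sum_pair_reflected[OF c] by (intro rat_cong_add rat_cong_refl)
  qed
  have "(\<Sum>j=1..m. 1 / (of_nat (2 * j))\<^sup>2) = T / 4"
    unfolding T_def sum_divide_distrib by (simp add: power_mult_distrib mult.commute)
  then have "rat_cong (T + T) (T / 4 + T / 4) p 1"
    using rat_cong_trans[OF rat_cong_sym[OF reflect[of 1]] reflect[of 2]]
    by (simp only: T_def mult_1 simp_thms)
  then have "rat_cong (2 * (1 / 3) * (T + T - (T / 4 + T / 4)))
      (2 * (1 / 3) * (T / 4 + T / 4 - (T / 4 + T / 4))) p 1"
    using \<open>p > 3\<close>
    by (intro rat_cong_mult_left rat_cong_diff rat_cong_refl Z_loc_mult Z_loc_numeral
        Z_loc_inverse_unit Z_loc_units_numeral) simp_all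
  then show ?thesis
    by (simp add: T_def)
qed

lemma prod_diff_expand:
  assumes "finite J" "\<And>j. j \<in> J \<Longrightarrow> a j \<in> Z_loc_units" "y \<in> Z_loc p"
  obtains z where "z \<in> Z_loc p"
    and "(\<Prod>j\<in>J. a j - y) = prod a J * (1 - y * (\<Sum>j\<in>J. 1 / a j)) + y\<^sup>2 * z"
  using assms(1,2)
proof (induction J arbitrary: thesis rule: finite_induct)
  case empty
  show ?case by (rule empty.prems(1)[of 0]) (simp_all add: Z_loc_closed)
next
  case (insert i J)
  have a: "a i \<in> Z_loc_units" "\<And>j. j \<in> J \<Longrightarrow> a j \<in> Z_loc_units"
    using insert.prems by auto
  obtain z where z: "z \<in> Z_loc p"
      "(\<Prod>j\<in>J. a j - y) = prod a J * (1 - y * (\<Sum>j\<in>J. 1 / a j)) + y\<^sup>2 * z"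
    using insert.IH a(2) by blast
  show ?case
  proof (rule insert.prems(1))
    show "z * (a i - y) + prod a J * (\<Sum>j\<in>J. 1 / a j) \<in> Z_loc p"
      using z(1) assms(3) a[THEN Z_loc_units_in_Z_loc] a(2)[THEN Z_loc_inverse_unit]
      by (simp add: Z_loc_closed)
    show "(\<Prod>j\<in>insert i J. a j - y) = prod a (insert i J) * (1 - y * (\<Sum>j\<in>insert i J. 1 / a j))
        + y\<^sup>2 * (z * (a i - y) + prod a J * (\<Sum>j\<in>J. 1 / a j))"
      using insert.hyps Z_loc_units_nonzero[OF a(1)]
      by (simp add: z(2) field_simps power2_eq_square)
  qed
qed

lemma prod_diff_cong:
  assumes "finite J" and a: "\<And>j. j \<in> J \<Longrightarrow> a j \<in> Z_loc_units"
    and "rat_cong y 0 p 2" and "rat_cong (\<Sum>j\<in>J. 1 / a j) 0 p 1"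
  shows "rat_cong (\<Prod>j\<in>J. a j - y) (prod a J) p 3"
proof -
  obtain u s where u: "u \<in> Z_loc p" "y = of_nat p ^ 2 * u"
    and s: "s \<in> Z_loc p" "(\<Sum>j\<in>J. 1 / a j) = of_nat p * s"
    using assms(3,4) by (elim rat_congE) simp
  then have "y \<in> Z_loc p"
    by (simp add: Z_loc_closed)
  then obtain z where z: "z \<in> Z_loc p"
      "(\<Prod>j\<in>J. a j - y) = prod a J * (1 - y * (\<Sum>j\<in>J. 1 / a j)) + y\<^sup>2 * z"
    using prod_diff_expand[of J a y] assms(1) a by blast
  show ?thesis
  proof (rule rat_congI)
    show "of_nat p * u ^ 2 * z - prod a J * u * s \<in> Z_loc p"
      using u(1) s(1) z(1) a[THEN Z_loc_units_in_Z_loc] by (simp add: Z_loc_closed)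
    show "(\<Prod>j\<in>J. a j - y) = prod a J + of_nat p ^ 3 * (of_nat p * u ^ 2 * z - prod a J * u * s)"
      unfolding z(2) unfolding s(2) u(2)
      by (simp add: algebra_simps power2_eq_square power3_eq_cube)
  qed
qed

lemma half_Z_loc: "p = 2 * m + 1 \<Longrightarrow> 1/2 \<in> Z_loc p"
  using prime_gt_1_nat[OF prime_p] by (intro Z_loc_inverse_unit Z_loc_units_numeral) simp

lemma pochhammer_half_cong_0:
  assumes "p = 2 * m + 1"
  shows "rat_cong (pochhammer (1/2) p) 0 p 1"
proof (rule rat_congI)
  show "1/2 * (\<Prod>i\<in>{0..<p} - {m}. 1/2 + of_nat i) \<in> Z_loc p"
    using half_Z_loc[OF assms] by (intro Z_loc_closed)
  have "pochhammer (1/2 :: rat) p = (1/2 + of_nat m) * (\<Prod>i\<in>{0..<p} - {m}. 1/2 + of_nat i)"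
    unfolding pochhammer_prod using assms by (intro prod.remove) auto
  also have "1/2 + of_nat m = of_nat p * (1/2 :: rat)"
    by (simp add: assms)
  finally show "pochhammer (1/2 :: rat) p
      = 0 + of_nat p ^ 1 * (1/2 * (\<Prod>i\<in>{0..<p} - {m}. 1/2 + of_nat i))"
    by simp
qed

lemma prod_even_squares_cong:
  assumes m: "p = 2 * m + 1" and "p > 3"
  shows "rat_cong (\<Prod>j<m. (2 * of_nat (Suc j))\<^sup>2 - (of_nat m + 1/2)\<^sup>2)
    (\<Prod>j<m. (2 * of_nat (Suc j))\<^sup>2) p 3"
proof (rule prod_diff_cong)
  have quarter: "1/4 \<in> Z_loc p"
    using assms by (intro Z_loc_inverse_unit Z_loc_units_numeral) simp
  show "(2 * of_nat (Suc j))\<^sup>2 \<in> Z_loc_units" if "j \<in> {..<m}" for j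
    using that assms
    by (intro Z_loc_units_power Z_loc_units_mult Z_loc_units_of_nat Z_loc_units_numeral) auto
  show "rat_cong ((of_nat m + 1/2)\<^sup>2) 0 p 2"
    by (rule rat_congI[OF _ quarter]) (simp add: m field_simps power2_eq_square)
  have "(\<Sum>j<m. 1 / (2 * of_nat (Suc j))\<^sup>2 :: rat) = 1/4 * (\<Sum>j=1..m. 1 / (of_nat j)\<^sup>2)"
    unfolding sum_distrib_left One_nat_def sum.atLeast1_atMost_eq
    by (simp add: power_mult_distrib del: of_nat_Suc)
  then show "rat_cong (\<Sum>j<m. 1 / (2 * of_nat (Suc j))\<^sup>2) 0 p 1"
    using rat_cong_mult_left[OF sum_inverse_squares_cong_0[OF assms] quarter]
    by (simp only: mult_zero_right)
qed simp

lemma gs_sum_of_nat_cong: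
  assumes m: "p = 2 * m + 1" and "p > 3"
  shows "rat_cong (gs_sum (1/2) (of_nat m) ((of_nat m + 1/2)\<^sup>2) m) (gs_sum (1/2) (of_nat m) 0 m) p 4"
proof -
  define \<Pi> :: "rat \<Rightarrow> rat" where "\<Pi> y = (\<Prod>j<m. (2 * of_nat (Suc j))\<^sup>2 - y)" for y
  define y :: rat where "y = (of_nat m + 1/2)\<^sup>2"
  have cong: "rat_cong (\<Pi> y) (\<Pi> 0) p 3"
    using prod_even_squares_cong[OF assms] by (simp add: \<Pi>_def y_def)
  have unit: "\<Pi> 0 \<in> Z_loc_units"
    unfolding \<Pi>_def diff_0_right using assms
    by (intro Z_loc_units_prod Z_loc_units_power Z_loc_units_mult Z_loc_units_of_nat Z_loc_units_numeral) auto
  moreover have "\<Pi> y \<in> Z_loc_units"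
    using rat_cong_unit[OF rat_cong_mono[OF cong] unit] by simp
  ultimately have "rat_cong (pochhammer (1/2) p * (1 / \<Pi> y)) (pochhammer (1/2) p * (1 / \<Pi> 0)) p (1 + 3)"
    using cong by (intro rat_cong_mult_left_cong_0 pochhammer_half_cong_0[OF m] rat_cong_inverse)
  moreover have "gs_sum (1/2) (of_nat m) z m = pochhammer (1/2) p * (1 / \<Pi> z)" if "\<Pi> z \<noteq> 0" for z
    using that gs_sum_half_of_nat[of m z] by (simp add: \<Pi>_def m)
  ultimately show ?thesis
    using Z_loc_units_nonzero[OF unit] Z_loc_units_nonzero[OF \<open>\<Pi> y \<in> Z_loc_units\<close>]
    by (simp add: y_def)
qed

lemma gs_denom_unit:
  assumes p: "p > 2" and k: "2 * k + 1 < p"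
    and e: "rat_cong e (1/2) p 1" and n: "rat_cong n (- 1/2) p 1" and y: "rat_cong y 0 p 1"
  shows "gs_denom e n y k \<in> Z_loc_units"
  unfolding gs_denom_def
proof (intro Z_loc_units_mult)
  show "of_nat k + 1 \<in> Z_loc_units"
    using Z_loc_units_of_nat[of "Suc k"] k by (simp add: add.commute)
  show "1 + e + 2 * n + of_nat k \<in> Z_loc_units"
  proof (rule rat_cong_unit)
    show "rat_cong (1 + e + 2 * n + of_nat k) (1 + 1/2 + 2 * (- 1/2) + of_nat k) p 1"
      by (intro rat_cong_add rat_cong_mult_left rat_cong_refl e n Z_loc_numeral)
    have "of_nat (2 * k + 1) * (1/2) \<in> Z_loc_units"
      using p k
      by (intro Z_loc_units_mult Z_loc_units_of_nat Z_loc_units_inverse Z_loc_units_numeral) auto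
    then show "1 + 1/2 + 2 * (- 1/2) + of_nat k \<in> Z_loc_units"
      by (simp add: field_simps)
  qed
  show "(e + 3/2 + 2 * of_nat k)\<^sup>2 - y \<in> Z_loc_units"
  proof (rule rat_cong_unit)
    have "rat_cong (e + 3/2 + 2 * of_nat k) (1/2 + 3/2 + 2 * of_nat k) p 1"
      by (intro rat_cong_add rat_cong_refl e)
    also have "1/2 + 3/2 + 2 * of_nat k = (2 * of_nat (Suc k) :: rat)"
      by simp
    finally show "rat_cong ((e + 3/2 + 2 * of_nat k)\<^sup>2 - y) ((2 * of_nat (Suc k))\<^sup>2 - 0) p 1"
      by (intro rat_cong_diff rat_cong_power y Z_loc_closed)
    show "(2 * of_nat (Suc k))\<^sup>2 - 0 \<in> Z_loc_units"
      unfolding diff_0_right using p k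
      by (intro Z_loc_units_power Z_loc_units_mult Z_loc_units_of_nat Z_loc_units_numeral) auto
  qed
qed

end

section \<open>Divisibility of mixed differences\<close>

locale integral_function_ring = localization_at_prime p + function_subring A
  for p :: nat and A :: "('c \<Rightarrow> rat) set" +
  assumes inverse: "f \<in> A \<Longrightarrow> (\<And>x. f x \<in> Z_loc_units) \<Longrightarrow> (\<lambda>x. 1 / f x) \<in> A"
begin

lemma half: "p > 2 \<Longrightarrow> (\<lambda>_. 1/2) \<in> A"
  by (intro inverse numeral Z_loc_units_numeral) simp

lemma half_odd: "p > 2 \<Longrightarrow> (\<lambda>_. of_nat m + 1/2) \<in> A"
  by (intro add of_nat half)

lemma gs_sum_mem:
  assumes mem: "e \<in> A" "n \<in> A" "y \<in> A"
    and cong: "\<And>x. rat_cong (e x) (1/2) p 1" "\<And>x. rat_cong (n x) (- 1/2) p 1"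
      "\<And>x. rat_cong (y x) 0 p 1"
    and m: "p = 2 * m + 1"
  shows "(\<lambda>x. gs_sum (e x) (n x) (y x) m) \<in> A"
proof (rule gs_sum_function_subring)
  have p: "p > 2"
    using m prime_gt_1_nat[OF prime_p] by simp
  show "(\<lambda>_. 1/2) \<in> A"
    using p by (rule half)
  fix k assume "k < m"
  then have k: "2 * k + 1 < p"
    by (simp add: m)
  have "(\<lambda>_. 3 * (1/2)) \<in> A"
    by (intro mult numeral half p)
  then have "(\<lambda>x. gs_denom (e x) (n x) (y x) k) \<in> A"
    unfolding gs_denom_def using mem by (intro closed) simp_all
  then show "(\<lambda>x. 1 / gs_denom (e x) (n x) (y x) k) \<in> A"
    using gs_denom_unit[OF p k cong] by (rule inverse)
qed (use mem function_subring_axioms in auto)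

end

text \<open>
  Iterating this construction gives functions on a cube whose mixed differences are divisible
  by the product of the weights \<open>w\<close>.
\<close>

definition boolean_extension :: "'a::comm_ring_1 \<Rightarrow> ('c \<Rightarrow> 'a) set \<Rightarrow> (bool \<times> 'c \<Rightarrow> 'a) set" where
  "boolean_extension w A = {f. \<exists>g\<in>A. \<exists>h\<in>A. \<forall>b c. f (b, c) = g c + of_bool b * (w * h c)}"

lemma boolean_extensionI:
  "g \<in> A \<Longrightarrow> h \<in> A \<Longrightarrow> (\<And>b c. f (b, c) = g c + of_bool b * (w * h c)) \<Longrightarrow> f \<in> boolean_extension w A"
  unfolding boolean_extension_def by blast

lemma boolean_extensionE:
  assumes "f \<in> boolean_extension w A"
  obtains g h where "g \<in> A" "h \<in> A" "\<And>b c. f (b, c) = g c + of_bool b * (w * h c)"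
  using assms unfolding boolean_extension_def by blast

lemma boolean_extension_fst:
  assumes "function_subring A"
  shows "(\<lambda>x. w * of_bool (fst x)) \<in> boolean_extension w A"
proof -
  interpret function_subring A by fact
  show ?thesis
    by (rule boolean_extensionI[OF zero one]) simp
qed

lemma boolean_extension_snd:
  assumes "function_subring A" and "f \<in> A"
  shows "(\<lambda>x. f (snd x)) \<in> boolean_extension w A"
proof -
  interpret function_subring A by fact
  show ?thesis
    by (rule boolean_extensionI[OF assms(2) zero]) simp
qed

lemma function_subring_boolean_extension:
  assumes "function_subring A" and w: "(\<lambda>_. w) \<in> A"
  shows "function_subring (boolean_extension w A)"
proof
  interpret function_subring A by fact
  show "(\<lambda>_. 1) \<in> boolean_extension w A"
    by (rule boolean_extensionI[OF one zero]) simp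
  fix f f' assume "f \<in> boolean_extension w A" "f' \<in> boolean_extension w A"
  then obtain g h g' h' where A: "g \<in> A" "h \<in> A" "g' \<in> A" "h' \<in> A"
      and f: "\<And>b c. f (b, c) = g c + of_bool b * (w * h c)"
      and f': "\<And>b c. f' (b, c) = g' c + of_bool b * (w * h' c)"
    by (elim boolean_extensionE) blast
  show "(\<lambda>x. f x - f' x) \<in> boolean_extension w A"
    by (rule boolean_extensionI[OF diff diff, OF A(1,3,2,4)]) (simp add: f f' algebra_simps)
  have "(\<lambda>c. g c * h' c + h c * g' c + w * (h c * h' c)) \<in> A"
    using A w by (intro closed)
  with mult[OF A(1,3)] show "(\<lambda>x. f x * f' x) \<in> boolean_extension w A"
    by (rule boolean_extensionI) (simp add: f f' algebra_simps)
qed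

lemma boolean_extension_coordinates:
  fixes A :: "('c \<Rightarrow> 'a::comm_ring_1) set" and u v w :: 'a
  defines "B \<equiv> boolean_extension u (boolean_extension v (boolean_extension w A))"
  assumes A: "function_subring A" and w: "(\<lambda>_. w) \<in> A" and v: "(\<lambda>_. v) \<in> boolean_extension w A"
  shows "(\<lambda>x. u * of_bool (fst x)) \<in> B"
    and "(\<lambda>x. v * of_bool (fst (snd x))) \<in> B"
    and "(\<lambda>x. w * of_bool (fst (snd (snd x)))) \<in> B"
proof -
  have edge: "function_subring (boolean_extension w A)"
    using A w by (rule function_subring_boolean_extension)
  then have face: "function_subring (boolean_extension v (boolean_extension w A))"
    using v by (rule function_subring_boolean_extension)
  show "(\<lambda>x. u * of_bool (fst x)) \<in> B"
    unfolding B_def by (rule boolean_extension_fst[OF face])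
  show "(\<lambda>x. v * of_bool (fst (snd x))) \<in> B"
    unfolding B_def by (rule boolean_extension_snd[OF face boolean_extension_fst[OF edge]])
  show "(\<lambda>x. w * of_bool (fst (snd (snd x)))) \<in> B"
    unfolding B_def
    by (rule boolean_extension_snd[OF face boolean_extension_snd[OF edge boolean_extension_fst[OF A]]])
qed

lemma (in integral_function_ring) integral_function_ring_boolean_extension:
  assumes w: "(\<lambda>_. w) \<in> A"
  shows "integral_function_ring p (boolean_extension w A)"
proof (intro_locales)
  show "function_subring (boolean_extension w A)"
    using function_subring_axioms w by (rule function_subring_boolean_extension)
  show "integral_function_ring_axioms p (boolean_extension w A)"
  proof
    fix f assume "f \<in> boolean_extension w A" and unit: "\<And>x. f x \<in> Z_loc_units"
    then obtain g h where A: "g \<in> A" "h \<in> A" and f: "\<And>b c. f (b, c) = g c + of_bool b * (w * h c)"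
      by (elim boolean_extensionE) blast
    have top: "g c + w * h c \<in> Z_loc_units" and bot: "g c \<in> Z_loc_units" for c
      using unit[of "(True, c)"] unit[of "(False, c)"] by (simp_all add: f)
    have inv_top: "(\<lambda>c. 1 / (g c + w * h c)) \<in> A"
      using A w top by (intro inverse closed)
    have inv_bot: "(\<lambda>c. 1 / g c) \<in> A"
      by (rule inverse[OF A(1) bot])
    show "(\<lambda>x. 1 / f x) \<in> boolean_extension w A"
    proof (rule boolean_extensionI[OF inv_bot])
      show "(\<lambda>c. 0 - h c * (1 / g c) * (1 / (g c + w * h c))) \<in> A"
        using A inv_top inv_bot by (intro closed)
      show "1 / f (b, c) = 1 / g c + of_bool b * (w * (0 - h c * (1 / g c) * (1 / (g c + w * h c))))" for b c
        using Z_loc_units_nonzero[OF top[of c]] Z_loc_units_nonzero[OF bot[of c]]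
        by (cases b) (simp_all add: f divide_simps)
    qed
  qed
qed

lemma boolean_extension_difference:
  assumes "f \<in> boolean_extension w A"
  obtains h where "h \<in> A" "\<And>c. f (True, c) - f (False, c) = w * h c"
  using assms by (elim boolean_extensionE) simp

lemma boolean_extension_alternating_sum:
  assumes "f \<in> boolean_extension u (boolean_extension v (boolean_extension w A))"
  obtains h where "h \<in> A"
    and "\<And>c. f (True, True, True, c) - f (True, True, False, c)
      - f (True, False, True, c) + f (True, False, False, c)
      - f (False, True, True, c) + f (False, True, False, c)
      + f (False, False, True, c) - f (False, False, False, c) = u * v * w * h c"
proof -
  obtain f_u where f_u: "f_u \<in> boolean_extension v (boolean_extension w A)"
      "\<And>c. f (True, c) - f (False, c) = u * f_u c"
    using assms by (rule boolean_extension_difference) blast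
  obtain f_uv where f_uv: "f_uv \<in> boolean_extension w A"
      "\<And>c. f_u (True, c) - f_u (False, c) = v * f_uv c"
    using f_u(1) by (rule boolean_extension_difference) blast
  obtain h where h: "h \<in> A" "\<And>c. f_uv (True, c) - f_uv (False, c) = w * h c"
    using f_uv(1) by (rule boolean_extension_difference) blast
  have "u * v * w * h c = u * ((f_u (True, True, c) - f_u (False, True, c))
      - (f_u (True, False, c) - f_u (False, False, c)))" for c
    unfolding f_uv(2) by (simp add: mult.assoc right_diff_distrib flip: h(2))
  also have "\<dots> c = f (True, True, True, c) - f (True, True, False, c)
      - f (True, False, True, c) + f (True, False, False, c)
      - f (False, True, True, c) + f (False, True, False, c)
      + f (False, False, True, c) - f (False, False, False, c)" for c
    unfolding right_diff_distrib by (simp flip: f_u(2))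
  finally show thesis
    using that h(1) by simp
qed

section \<open>The cube of parameters\<close>

text \<open>The summand \<open>2 * s * t\<close> makes the second argument a natural number also for \<open>s = t = h\<close>.\<close>

definition gs_corner :: "nat \<Rightarrow> bool \<Rightarrow> bool \<Rightarrow> bool \<Rightarrow> rat" where
  "gs_corner m i j k =
     (let h = of_nat m + 1/2; s = h * of_bool i; r = h\<^sup>2 * of_bool j; t = h * of_bool k
      in gs_sum (1/2 - s) (s + t + 2 * s * t - 1/2) r m)"

lemma half_odd_diff_neq:
  "(3/2 - of_nat m + 2 * of_nat l)\<^sup>2 \<noteq> (of_nat m + 1/2 :: 'a::field_char_0)\<^sup>2 * of_bool j"
proof (cases j)
  case True
  have "2 * l + 1 \<noteq> 2 * m" by presburger
  then have "of_nat (2 * l + 1) \<noteq> (of_nat (2 * m) :: 'a)"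
    unfolding of_nat_eq_iff .
  moreover have "of_nat (2 * l + 2) \<noteq> (0 :: 'a)"
    unfolding of_nat_eq_0_iff by simp
  ultimately have "of_nat (2 * l + 2) * (of_nat (2 * l + 1) - of_nat (2 * m)) \<noteq> (0 :: 'a)"
    unfolding mult_eq_0_iff right_minus_eq by blast
  also have "of_nat (2 * l + 2) * (of_nat (2 * l + 1) - of_nat (2 * m))
      = (3/2 - of_nat m + 2 * of_nat l)\<^sup>2 - (of_nat m + 1/2 :: 'a)\<^sup>2"
    by (simp add: field_simps power2_eq_square)
  finally show ?thesis
    using True by simp
next
  case False
  have "3 + 4 * l \<noteq> 2 * m" by presburger
  then have "of_nat (3 + 4 * l) \<noteq> (of_nat (2 * m) :: 'a)"
    unfolding of_nat_eq_iff .
  with False show ?thesis by (auto simp: field_simps)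
qed

lemma gs_corner_eq_0: "gs_corner m True j k = 0"
proof -
  have zero: "gs_sum (- of_nat m) (of_nat n) ((of_nat m + 1/2)\<^sup>2 * of_bool j) m = (0 :: rat)"
    if "m \<le> n" for n
    using that half_odd_diff_neq by (rule gs_sum_neg_of_nat)
  show ?thesis
  proof (cases k)
    case True
    then show ?thesis
      using zero[of "2 * m\<^sup>2 + 4 * m + 1"]
      by (simp add: gs_corner_def algebra_simps power2_eq_square)
  next
    case False
    then show ?thesis
      using zero[of m] by (simp add: gs_corner_def)
  qed
qed

lemma gs_corner_of_nat:
  "gs_corner m False j True = gs_sum (1/2) (of_nat m) ((of_nat m + 1/2)\<^sup>2 * of_bool j) m"
  by (simp add: gs_corner_def)

lemma gs_corner_half_odd: "gs_corner m False True False = (-1) ^ m * of_nat (2 * m + 1) / 2"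
  using gs_sum_half_minus_half[of m, where 'a = rat] by (simp add: gs_corner_def)

lemma gs_corner_base: "gs_corner m False False False = gs_sum (1/2) (- 1/2) 0 m"
  by (simp add: gs_corner_def)

context localization_at_prime
begin

lemma integral_function_ring_point: "integral_function_ring p {f :: unit \<Rightarrow> rat. f () \<in> Z_loc p}"
  by unfold_locales (auto intro: Z_loc_closed Z_loc_inverse_unit)

definition cube_functions :: "rat \<Rightarrow> (bool \<times> bool \<times> bool \<times> unit \<Rightarrow> rat) set" where
  "cube_functions h =
     boolean_extension h (boolean_extension (h\<^sup>2) (boolean_extension h {f. f () \<in> Z_loc p}))"

lemma
  assumes p: "p > 2" and h: "h = of_nat m + 1/2"
  shows integral_function_ring_cube_functions: "integral_function_ring p (cube_functions h)"
    and cube_functions_coordinates: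
      "(\<lambda>x. h * of_bool (fst x)) \<in> cube_functions h"
      "(\<lambda>x. h\<^sup>2 * of_bool (fst (snd x))) \<in> cube_functions h"
      "(\<lambda>x. h * of_bool (fst (snd (snd x)))) \<in> cube_functions h"
proof -
  interpret point: integral_function_ring p "{f :: unit \<Rightarrow> rat. f () \<in> Z_loc p}"
    by (rule integral_function_ring_point)
  have h_mem: "(\<lambda>_. h) \<in> {f :: unit \<Rightarrow> rat. f () \<in> Z_loc p}"
    unfolding h using p by (rule point.half_odd)
  then interpret edge: integral_function_ring p "boolean_extension h {f :: unit \<Rightarrow> rat. f () \<in> Z_loc p}"
    by (rule point.integral_function_ring_boolean_extension)
  have h2_mem: "(\<lambda>_. h\<^sup>2) \<in> boolean_extension h {f :: unit \<Rightarrow> rat. f () \<in> Z_loc p}"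
    using edge.power[OF edge.half_odd[OF p, of m], of 2] by (simp only: h)
  then interpret face: integral_function_ring p
      "boolean_extension (h\<^sup>2) (boolean_extension h {f :: unit \<Rightarrow> rat. f () \<in> Z_loc p})"
    by (rule edge.integral_function_ring_boolean_extension)
  show "integral_function_ring p (cube_functions h)"
    unfolding cube_functions_def using face.half_odd[OF p, of m]
    by (intro face.integral_function_ring_boolean_extension) (simp only: h)
  show "(\<lambda>x. h * of_bool (fst x)) \<in> cube_functions h"
    and "(\<lambda>x. h\<^sup>2 * of_bool (fst (snd x))) \<in> cube_functions h"
    and "(\<lambda>x. h * of_bool (fst (snd (snd x)))) \<in> cube_functions h"
    unfolding cube_functions_def
    by (intro boolean_extension_coordinates point.function_subring_axioms h_mem h2_mem)+
qed

lemma
  assumes m: "p = 2 * m + 1" and h: "h = of_nat m + 1/2"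
  shows gs_corner_e_cong: "rat_cong (1/2 - h * of_bool i) (1/2) p 1"
    and gs_corner_n_cong:
      "rat_cong (h * of_bool i + h * of_bool k + 2 * (h * of_bool i) * (h * of_bool k) - 1/2)
        (- 1/2) p 1"
    and gs_corner_y_cong: "rat_cong (h\<^sup>2 * of_bool j) 0 p 1"
proof -
  have cong_0: "rat_cong h 0 p 1"
    by (rule rat_congI[OF _ half_Z_loc[OF m]]) (simp add: h m)
  then have h_Z_loc: "h \<in> Z_loc p"
    by (rule rat_cong_Z_loc) (rule Z_loc_numeral)
  have multiple: "rat_cong (h * c) 0 p 1" if "c \<in> Z_loc p" for c
    using rat_cong_mult_left[OF cong_0 that] by (simp add: mult.commute)
  have "rat_cong (1/2 - h * of_bool i) (1/2 - 0) p 1"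
    by (intro rat_cong_diff rat_cong_refl multiple Z_loc_closed)
  then show "rat_cong (1/2 - h * of_bool i) (1/2) p 1"
    by simp
  have "rat_cong (h * (of_bool i + of_bool k + 2 * of_bool i * (h * of_bool k)) - 1/2) (0 - 1/2) p 1"
    by (intro rat_cong_diff rat_cong_refl multiple Z_loc_closed h_Z_loc)
  then show "rat_cong (h * of_bool i + h * of_bool k + 2 * (h * of_bool i) * (h * of_bool k) - 1/2)
        (- 1/2) p 1"
    by (simp add: algebra_simps)
  have "rat_cong (h * (h * of_bool j)) 0 p 1"
    by (intro multiple Z_loc_closed h_Z_loc)
  then show "rat_cong (h\<^sup>2 * of_bool j) 0 p 1"
    by (simp add: power2_eq_square mult.assoc)
qed

lemma gs_corner_mem_cube_functions:
  assumes m: "p = 2 * m + 1" and h: "h = of_nat m + 1/2"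
  shows "(\<lambda>(i, j, k, _). gs_corner m i j k) \<in> cube_functions h"
proof -
  have p: "p > 2"
    using m prime_gt_1_nat[OF prime_p] by simp
  interpret integral_function_ring p "cube_functions h"
    using p h by (rule integral_function_ring_cube_functions)
  note coordinates = cube_functions_coordinates[OF p h]
  have "(\<lambda>x. gs_sum (1/2 - h * of_bool (fst x))
      (h * of_bool (fst x) + h * of_bool (fst (snd (snd x)))
        + 2 * (h * of_bool (fst x)) * (h * of_bool (fst (snd (snd x)))) - 1/2)
      (h\<^sup>2 * of_bool (fst (snd x))) m) \<in> cube_functions h"
  proof (rule gs_sum_mem[OF _ _ coordinates(2) gs_corner_e_cong[OF m h] gs_corner_n_cong[OF m h]
        gs_corner_y_cong[OF m h] m])
    show "(\<lambda>x. 1/2 - h * of_bool (fst x)) \<in> cube_functions h"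
      by (intro diff half p coordinates)
    show "(\<lambda>x. h * of_bool (fst x) + h * of_bool (fst (snd (snd x)))
        + 2 * (h * of_bool (fst x)) * (h * of_bool (fst (snd (snd x)))) - 1/2) \<in> cube_functions h"
      by (rule diff[OF add[OF add mult[OF mult]] half[OF p]]) (rule coordinates numeral)+
  qed
  then show ?thesis
    by (simp add: gs_corner_def h Let_def case_prod_unfold)
qed

lemma gs_corner_base_cong:
  assumes m: "p = 2 * m + 1"
  shows "rat_cong (gs_corner m False False False)
    (gs_corner m False True False + (gs_corner m False False True - gs_corner m False True True)) p 4"
proof -
  define h :: rat where "h = of_nat m + 1/2"
  obtain f :: "unit \<Rightarrow> rat" where f: "f () \<in> Z_loc p"
    and "gs_corner m True True True - gs_corner m True True False
      - gs_corner m True False True + gs_corner m True False False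
      - gs_corner m False True True + gs_corner m False True False
      + gs_corner m False False True - gs_corner m False False False = h * h\<^sup>2 * h * f ()"
    using boolean_extension_alternating_sum[OF gs_corner_mem_cube_functions[OF m h_def,
        unfolded cube_functions_def]]
    unfolding prod.case by blast
  then have "gs_corner m False False False
      = gs_corner m False True False + (gs_corner m False False True - gs_corner m False True True)
        - h ^ 4 * f ()"
    by (simp add: gs_corner_eq_0 power2_eq_square power4_eq_xxxx)
  also have "h ^ 4 * f () = of_nat p ^ 4 * ((1/2) ^ 4 * f ())"
  proof -
    have "h = of_nat p * (1/2)"
      by (simp add: h_def m)
    then show ?thesis
      by (simp only: power_mult_distrib mult.assoc)
  qed
  finally show ?thesis
    by (intro rat_congI[of _ _ _ "- ((1/2) ^ 4 * f ())"] Z_loc_closed half_Z_loc[OF m] f) simp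
qed

theorem gs_sum_half_cong:
  assumes m: "p = 2 * m + 1" and "p > 3"
  shows "rat_cong (2 * gs_sum (1/2) (- 1/2) 0 m) ((-1) ^ m * of_nat p) p 4"
proof -
  have agree: "rat_cong (gs_corner m False False True) (gs_corner m False True True) p 4"
    using rat_cong_sym[OF gs_sum_of_nat_cong[OF assms]] by (simp add: gs_corner_of_nat)
  have "rat_cong (gs_corner m False False False)
      (gs_corner m False True False + (gs_corner m False False True - gs_corner m False True True)) p 4"
    by (rule gs_corner_base_cong[OF m])
  also have "rat_cong
      (gs_corner m False True False + (gs_corner m False False True - gs_corner m False True True))
      (gs_corner m False True False + (gs_corner m False True True - gs_corner m False True True)) p 4"
    by (intro rat_cong_add rat_cong_diff rat_cong_refl agree)
  finally have "rat_cong (2 * gs_corner m False False False)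
      (2 * (gs_corner m False True False +
        (gs_corner m False True True - gs_corner m False True True))) p 4"
    by (intro rat_cong_mult_left Z_loc_numeral)
  then show ?thesis
    by (simp add: gs_corner_base gs_corner_half_odd m)
qed

end

lemma gs_term_half_minus_half:
  "gs_term (1/2) (- 1/2) 0 k = (pochhammer (1/2) k / fact k) ^ 3 / (4 :: 'a::linordered_field) ^ k"
proof -
  have num: "(\<Prod>j<k. (1/2 + of_nat j)\<^sup>2 - 0) = (pochhammer (1/2 :: 'a) k)\<^sup>2"
    by (simp add: pochhammer_prod prod_power_distrib atLeast0LessThan)
  have denom: "(\<Prod>j<k. (1/2 + 3/2 + 2 * of_nat j)\<^sup>2 - 0) = (4 :: 'a) ^ k * (fact k)\<^sup>2"
    by (induction k) (simp_all add: field_simps power2_eq_square)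
  have "1 + 1/2 + 2 * (- 1/2) = (1/2 :: 'a)" and "- (- 1/2) = (1/2 :: 'a)"
    by simp_all
  moreover have "pochhammer (1/2 :: 'a) k \<noteq> 0"
    using pochhammer_pos[of "1/2 :: 'a" k] by simp
  ultimately show ?thesis
    unfolding gs_term_def num denom
    by (simp only:) (simp add: power2_eq_square power3_eq_cube mult_ac)
qed

theorem theorem3:
  fixes p :: nat
  assumes "prime p" and "p > 3"
  shows "rat_cong
    (\<Sum>k = 0..(p - 1) div 2. of_nat (6 * k + 1) * (pochhammer (1 / 2) k / fact k) ^ 3 / 4 ^ k)
    ((-1) ^ ((p - 1) div 2) * of_nat p) p 4"
proof -
  interpret localization_at_prime p
    using assms(1) by unfold_locales
  define m where "m = (p - 1) div 2"
  have "odd p"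
    using assms by (simp add: prime_odd_nat)
  then have "p = 2 * m + 1"
    by (auto simp: m_def elim: oddE)
  then have "rat_cong (2 * gs_sum (1/2) (- 1/2) 0 m) ((-1) ^ m * of_nat p) p 4"
    using assms(2) by (rule gs_sum_half_cong)
  also have "2 * gs_sum (1/2) (- 1/2 :: rat) 0 m
      = (\<Sum>k = 0..m. of_nat (6 * k + 1) * (pochhammer (1 / 2) k / fact k) ^ 3 / 4 ^ k)"
    unfolding gs_sum_def gs_term_half_minus_half sum_distrib_left atLeast0AtMost
    by (intro sum.cong) (simp_all add: algebra_simps)
  finally show ?thesis
    unfolding m_def .
qed

end
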